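(* Let $q$ be a prime power, let $n\ge 2$ be an integer, and let $\Gamma$ be the singular difference graph of $M_n(\mathbb{F}_q)$. Then $\alpha(\Gamma)=q^n$.
   Context: $\mathbb{F}_q$ is the finite field with $q$ elements and $M_n(\mathbb{F}_q)$ is the vector space of all $n\times n$ matrices over $\mathbb{F}_q$. The singular difference graph $\Gamma$ of $M_n(\mathbb{F}_q)$ is the simple graph with vertex set $M_n(\mathbb{F}_q)$ in which two distinct matrices $A,B$ are adjacent if and only if $\det(A-B)=0$. The independence number $\alpha(\Gamma)$ is the maximum cardinality of an independent set of $\Gamma$, i.e. of a set of vertices no two distinct members of which are adjacent. *)

theory Defs
  imports
    "Graph_Theory.Graph_Theory"
    "Jordan_Normal_Form.Determinant"
    "HOL-Number_Theory.Prime_Powers"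
    "HOL-Library.Cardinality"
begin

text \<open>Simple graphs are the library's \<^locale>\<open>pair_graph\<close>: finite, symmetric, loop-free digraphs
  whose arcs are ordered pairs of vertices, so an edge between \<open>u\<close> and \<open>v\<close> is the pair of
  arcs \<open>(u, v)\<close> and \<open>(v, u)\<close>.\<close>

definition independent_set :: "'v pair_pre_digraph \<Rightarrow> 'v set \<Rightarrow> bool" where
  "independent_set G S \<longleftrightarrow>
     S \<subseteq> pverts G \<and> (\<forall>u\<in>S. \<forall>v\<in>S. u \<noteq> v \<longrightarrow> \<not> u \<rightarrow>\<^bsub>with_proj G\<^esub> v)"

text \<open>Only meaningful for finite \<open>G\<close>; the set below is then finite, and it contains
  \<open>0\<close> because the empty set is independent.\<close>

definition independence_number :: "'v pair_pre_digraph \<Rightarrow> nat" where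
  "independence_number G = Max {card S | S. independent_set G S}"

definition singular_difference_graph ::
    "nat \<Rightarrow> ('a :: {field, finite}) mat pair_pre_digraph" where
  "singular_difference_graph n =
     \<lparr> pverts = carrier_mat n n,
       parcs = {(A, B). A \<in> carrier_mat n n \<and> B \<in> carrier_mat n n \<and>
                        A \<noteq> B \<and> det (A - B) = 0} \<rparr>"

lemma finite_carrier_mat: "finite (carrier_mat m n :: 'a :: finite mat set)"
proof (rule finite_subset)
  let ?F = "({..<m} \<times> {..<n}) \<rightarrow>\<^sub>E (UNIV :: 'a set)"
  show "carrier_mat m n \<subseteq> mat m n ` ?F"
  proof
    fix A :: "'a mat" assume A: "A \<in> carrier_mat m n"
    have "A = mat m n (restrict (\<lambda>ij. A $$ ij) ({..<m} \<times> {..<n}))"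
      using A by (intro eq_matI) auto
    moreover have "restrict (\<lambda>ij. A $$ ij) ({..<m} \<times> {..<n}) \<in> ?F" by simp
    ultimately show "A \<in> mat m n ` ?F" by (rule image_eqI)
  qed
  show "finite (mat m n ` ?F)" by (intro finite_imageI finite_PiE) auto
qed

lemma pair_graph_singular_difference_graph:
  "pair_graph (singular_difference_graph n :: 'a :: {field, finite} mat pair_pre_digraph)"
proof -
  let ?G = "singular_difference_graph n :: 'a mat pair_pre_digraph"
  have det_swap: "det (B - A) = 0"
    if "A \<in> carrier_mat n n" "B \<in> carrier_mat n n" "det (A - B) = 0" for A B :: "'a mat"
  proof -
    have "B - A = (-1) \<cdot>\<^sub>m (A - B)" using that by (intro eq_matI) auto
    then show ?thesis using that(3) by simp
  qed
  have "parcs ?G \<subseteq> carrier_mat n n \<times> carrier_mat n n"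
    by (auto simp: singular_difference_graph_def)
  then have "finite (parcs ?G)"
    by (rule finite_subset) (simp add: finite_carrier_mat)
  moreover have "sym (parcs ?G)"
    using det_swap by (auto simp: singular_difference_graph_def sym_def)
  then have "symmetric (with_proj ?G)"
    by (simp add: symmetric_def arcs_ends_def arc_to_ends_def with_proj_def)
  ultimately show ?thesis
    by unfold_locales
      (auto simp: singular_difference_graph_def finite_carrier_mat)
qed

lemma finite_independent_sets:
  assumes "finite (pverts G)"
  shows "finite {card S | S. independent_set G S}"
proof -
  have "{card S | S. independent_set G S} \<subseteq> card ` Pow (pverts G)"
    by (auto simp: independent_set_def)
  then show ?thesis using assms by (meson finite_Pow_iff finite_imageI finite_subset)
qed

end

theory Submission
  imports Defs "HOL-Algebra.Algebraic_Closure_Type" "HOL-Number_Theory.Residues"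
begin

text \<open>
  Write \<open>q\<close> for the order of the ground field \<open>F\<close>.

  Upper bound: two matrices that agree in their first row have a difference with a zero row,
  which is singular. So the first row determines a member of an independent set, and there
  are only \<open>q ^ n\<close> possible first rows (\<open>independent_set_card_le\<close>).

  Lower bound: the field \<open>K\<close> with \<open>q ^ n\<close> elements is an \<open>n\<close>-dimensional vector space over
  \<open>F\<close>, so multiplication by \<open>x \<in> K\<close> is given by an \<open>n \<times> n\<close> matrix \<open>M x\<close> over \<open>F\<close>. The
  difference \<open>M x - M y\<close> represents multiplication by \<open>x - y\<close>, which is invertible unless
  \<open>x = y\<close>. Hence the \<open>q ^ n\<close> matrices \<open>M x\<close> are independent (\<open>exists_independent_set\<close>).

  The field \<open>K\<close> is realised inside an algebraic closure of \<open>F\<close> as the set of solutions of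
  \<open>x ^ (q ^ n) = x\<close>: there are exactly \<open>q ^ n\<close> of them because the polynomial is separable
  (\<open>card_fixed_points_power\<close>), and they are closed under addition because \<open>q ^ n\<close> is a power
  of the characteristic. A basis of \<open>K\<close> over \<open>F\<close> has \<open>n\<close> elements by counting coordinate
  vectors (\<open>subspace_basis_of_card\<close>).
\<close>

section \<open>Finite fields inside an algebraic closure\<close>

text \<open>
  Fermat's argument: multiplication by \<open>x \<noteq> 0\<close> permutes the nonzero elements, so it preserves
  their product.
\<close>
lemma power_card_eq_self:
  fixes x :: "'a :: {field, finite}"
  shows "x ^ CARD('a) = x"
proof (cases "x = 0")
  case False
  let ?U = "UNIV - {0 :: 'a}"
  have "(\<Prod>y\<in>?U. x * y) = \<Prod>?U"
    by (rule prod.reindex_bij_witness[of _ "\<lambda>y. y / x" "\<lambda>y. x * y"]) (use False in auto)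
  then have "x ^ card ?U * \<Prod>?U = \<Prod>?U"
    by (simp only: prod.distrib prod_constant)
  moreover have "\<Prod>?U \<noteq> 0" by simp
  ultimately have "x ^ card ?U = 1"
    by (metis mult_cancel_right1)
  moreover have "CARD('a) = Suc (card ?U)"
    using card_Suc_Diff1[of UNIV "0 :: 'a"] by simp
  ultimately show ?thesis by (simp only: power_Suc mult_1_right)
qed simp

text \<open>
  This identifies the prime below \<open>q\<close> with the characteristic, which is the prime for which
  the Frobenius map is additive.
\<close>
lemma card_eq_CHAR_power:
  assumes "primepow CARD('a :: {field, finite})"
  obtains k where "Factorial_Ring.prime CHAR('a)" "k > 0" "CARD('a) = CHAR('a) ^ k"
proof -
  have p: "Factorial_Ring.prime CHAR('a)"
    by (intro prime_CHAR_semidom finite_imp_CHAR_pos) auto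
  from assms obtain r k where r: "Factorial_Ring.prime r" "k > 0" "CARD('a) = r ^ k"
    by (auto simp: primepow_def)
  have "CHAR('a) dvd r ^ k"
    using CHAR_dvd_CARD[where ?'a = 'a] r(3) by simp
  then have "CHAR('a) = r"
    using p r(1) by (metis prime_dvd_power primes_dvd_imp_eq)
  with p r that show ?thesis by blast
qed

text \<open>
  The polynomial \<open>X ^ Q - X\<close> has derivative \<open>-1\<close> when \<open>Q\<close> vanishes in the field. A double
  root would also be a root of the derivative, so all \<open>Q\<close> roots are distinct.
\<close>
lemma card_fixed_points_power:
  assumes Q: "Q > 1" and Q0: "of_nat Q = (0 :: 'b :: alg_closed_field)"
  shows "card {x :: 'b. x ^ Q = x} = Q"
proof -
  define p :: "'b poly" where "p = Polynomial.monom 1 Q + [:0, -1:]"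
  have root: "poly p x = x ^ Q - x" for x
    by (simp add: p_def poly_monom)
  have deg: "Polynomial.degree p = Q"
    unfolding p_def using Q by (subst degree_add_eq_left) (auto simp: degree_monom_eq)
  have "pderiv p = [:-1:]"
    by (simp add: p_def pderiv_add pderiv_monom Q0 pderiv_pCons)
  then have pd: "poly (pderiv p) x = -1" for x by simp
  have p0: "p \<noteq> 0" using deg Q by auto
  obtain A where A: "size A = Polynomial.degree p"
    "p = smult (Polynomial.lead_coeff p) (\<Prod>x\<in>#A. [:-x, 1:])"
    using alg_closed_imp_factorization[OF p0] by metis
  have roots: "set_mset A = {x. x ^ Q = x}"
  proof -
    have "poly p x = 0 \<longleftrightarrow> x \<in># A" for x
      by (subst A(2)) (use p0 in \<open>auto simp: poly_prod_mset prod_mset_zero_iff\<close>)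
    then show ?thesis by (auto simp: root)
  qed
  have "count A x = 1" if "x \<in># A" for x
  proof (rule ccontr)
    assume "count A x \<noteq> 1"
    from that obtain B where B: "A = add_mset x B" by (blast dest: multi_member_split)
    with \<open>count A x \<noteq> 1\<close> have "x \<in># B"
      by (simp add: count_eq_zero_iff)
    then obtain C where "B = add_mset x C" by (blast dest: multi_member_split)
    with B have C: "A = {#x, x#} + C" by simp
    have "p = [:-x, 1:] * ([:-x, 1:] * smult (Polynomial.lead_coeff p) (\<Prod>x\<in>#C. [:-x, 1:]))"
      by (subst A(2)) (simp add: C mult_ac)
    then obtain r where r: "p = [:-x, 1:] * ([:-x, 1:] * r)" by blast
    have "poly (pderiv p) x = 0"
      by (simp only: r pderiv_mult poly_add poly_mult) simp
    with pd show False by simp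
  qed
  then have "size A = card (set_mset A)"
    by (simp add: size_multiset_overloaded_eq)
  with A(1) deg roots show ?thesis by simp
qed

section \<open>The regular representation\<close>

text \<open>
  Over a finite field the dimension can be read off from the number of elements: the linear
  combinations of a basis \<open>B\<close> are in bijection with the functions from \<open>B\<close> to the field.
  The homomorphism \<open>h\<close> makes \<open>'b\<close> a vector space over \<open>'a\<close>; the basis is enumerated by
  numbers below \<open>n\<close> so that it can index the rows and columns of a matrix.
\<close>
lemma subspace_basis_of_card:
  fixes h :: "'a :: {field, finite} \<Rightarrow> 'b :: field" and K :: "'b set"
  assumes "field_hom h"
    and K0: "0 \<in> K"
    and Kadd: "\<And>x y. x \<in> K \<Longrightarrow> y \<in> K \<Longrightarrow> x + y \<in> K"
    and Kscale: "\<And>a x. x \<in> K \<Longrightarrow> h a * x \<in> K"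
    and card: "card K = CARD('a) ^ n"
  obtains b :: "nat \<Rightarrow> 'b" where
    "\<forall>i<n. b i \<in> K"
    "\<forall>c. (\<Sum>i<n. h (c i) * b i) = 0 \<longrightarrow> (\<forall>i<n. c i = 0)"
    "\<forall>x\<in>K. \<exists>c. x = (\<Sum>i<n. h (c i) * b i)"
proof -
  interpret field_hom h by fact
  interpret V: vector_space "\<lambda>a x. h a * x"
    by unfold_locales (auto simp: algebra_simps hom_distribs)
  have fin: "finite K"
    using card by (metis card_ge_0_finite finite zero_less_power zero_less_card_finite)
  have sub: "V.subspace K"
    using K0 Kadd Kscale by (auto simp: V.subspace_def)
  obtain B where B: "B \<subseteq> K" "V.independent B" "K \<subseteq> V.span B"
    by (rule V.maximal_independent_subset)
  have finB: "finite B" using B(1) fin by (rule finite_subset)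
  let ?f = "\<lambda>c. \<Sum>v\<in>B. h (c v) * v"
  have spanB: "K = range ?f"
    using B sub V.span_minimal[of B K] V.span_finite[OF finB] by auto
  have indep: "c v = 0" if "?f c = 0" "v \<in> B" for c v
    using V.independentD[OF B(2) finB subset_refl] that by blast
  \<comment> \<open>Extensional functions, so that each coordinate vector is counted once.\<close>
  have "bij_betw ?f (B \<rightarrow>\<^sub>E UNIV) K"
    unfolding bij_betw_def
  proof
    show "inj_on ?f (B \<rightarrow>\<^sub>E UNIV)"
    proof (rule inj_onI)
      fix c d :: "'b \<Rightarrow> 'a"
      assume c: "c \<in> B \<rightarrow>\<^sub>E UNIV" and d: "d \<in> B \<rightarrow>\<^sub>E UNIV" and eq: "?f c = ?f d"
      have "?f (\<lambda>v. c v - d v) = 0"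
        using eq by (simp add: hom_distribs algebra_simps sum_subtractf)
      from indep[OF this] have "c v = d v" if "v \<in> B" for v using that by simp
      with c d show "c = d" by (rule PiE_ext)
    qed
    have "?f c = ?f (restrict c B)" for c by (rule sum.cong) auto
    then show "?f ` (B \<rightarrow>\<^sub>E UNIV) = K"
      unfolding spanB by (auto intro!: image_eqI[of _ _ "restrict _ B"])
  qed
  then have "CARD('a) ^ card B = CARD('a) ^ n"
    using bij_betw_same_card card card_PiE[OF finB, of "\<lambda>_. UNIV :: 'a set"] by fastforce
  moreover have "CARD('a) > 1"
    using card_mono[of UNIV "{0, 1 :: 'a}"] by simp
  ultimately have "card B = n" by (metis power_inject_exp)
  then obtain b where b: "bij_betw b {..<n} B"
    using ex_bij_betw_nat_finite[OF finB] by (auto simp: atLeast0LessThan)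
  have reindex: "?f c = (\<Sum>i<n. h (c (b i)) * b i)" for c
    using sum.reindex_bij_betw[OF b, of "\<lambda>v. h (c v) * v"] by simp
  show ?thesis
  proof (rule that)
    show "\<forall>i<n. b i \<in> K"
      using b B(1) by (auto simp: bij_betw_def)
    show "\<forall>x\<in>K. \<exists>c. x = (\<Sum>i<n. h (c i) * b i)"
      unfolding spanB reindex by auto
    have "c i = 0" if c: "(\<Sum>i<n. h (c i) * b i) = 0" and i: "i < n" for c i
    proof -
      have inv: "inv_into {..<n} b (b j) = j" if "j < n" for j
        using b that by (auto simp: bij_betw_def inv_into_f_f)
      have "?f (\<lambda>v. c (inv_into {..<n} b v)) = 0"
        unfolding reindex using c by (simp add: inv)
      from indep[OF this, of "b i"] show ?thesis
        using b i by (auto simp: inv bij_betw_def)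
    qed
    then show "\<forall>c. (\<Sum>i<n. h (c i) * b i) = 0 \<longrightarrow> (\<forall>i<n. c i = 0)" by blast
  qed
qed

text \<open>
  Column \<open>j\<close> of \<open>M x\<close> holds the coordinates of \<open>x * b j\<close>. If \<open>v\<close> is a nonzero vector in the
  kernel of \<open>M x - M y\<close>, then the element \<open>w \<noteq> 0\<close> with coordinate vector \<open>v\<close> satisfies
  \<open>(x - y) * w = 0\<close>, and a field has no zero divisors.
\<close>
lemma multiplication_matrices:
  fixes h :: "'a :: field \<Rightarrow> 'b :: field" and K :: "'b set"
  assumes "field_hom h"
    and Kmult: "\<And>x y. x \<in> K \<Longrightarrow> y \<in> K \<Longrightarrow> x * y \<in> K"
    and bK: "\<forall>i<n. b i \<in> K"
    and indep: "\<forall>c. (\<Sum>i<n. h (c i) * b i) = 0 \<longrightarrow> (\<forall>i<n. c i = 0)"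
    and span: "\<forall>x\<in>K. \<exists>c. x = (\<Sum>i<n. h (c i) * b i)"
  obtains M :: "'b \<Rightarrow> 'a mat" where "range M \<subseteq> carrier_mat n n"
    "\<forall>x\<in>K. \<forall>y\<in>K. det (M x - M y) = 0 \<longrightarrow> x = y"
proof -
  interpret field_hom h by fact
  obtain coord where coord: "\<And>x. x \<in> K \<Longrightarrow> x = (\<Sum>i<n. h (coord x i) * b i)"
    using span by metis
  define M where "M x = mat n n (\<lambda>(i, j). coord (x * b j) i)" for x
  have carr: "M x \<in> carrier_mat n n" for x by (simp add: M_def)
  have key: "x = y" if x: "x \<in> K" and y: "y \<in> K" and det: "det (M x - M y) = 0" for x y
  proof -
    have D: "M x - M y \<in> carrier_mat n n" by (rule minus_carrier_mat[OF carr])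
    obtain v where v: "v \<in> carrier_vec n" "v \<noteq> 0\<^sub>v n" "(M x - M y) *\<^sub>v v = 0\<^sub>v n"
      using det det_0_iff_vec_prod_zero[OF D] by auto
    define w where "w = (\<Sum>j<n. h (vec_index v j) * b j)"
    have "w \<noteq> 0"
    proof
      assume "w = 0"
      then have "v = 0\<^sub>v n" using indep v(1) unfolding w_def by (intro eq_vecI) auto
      with v(2) show False by simp
    qed
    have entry: "(\<Sum>j<n. (coord (x * b j) i - coord (y * b j) i) * vec_index v j) = 0" if "i < n" for i
    proof -
      have "(\<Sum>j<n. (coord (x * b j) i - coord (y * b j) i) * vec_index v j) = ((M x - M y) *\<^sub>v v) $ i"
        using that v(1) D by (auto simp: scalar_prod_def M_def atLeast0LessThan intro!: sum.cong)
      with v(3) that show ?thesis by simp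
    qed
    have "(x - y) * w = (\<Sum>j<n. h (vec_index v j) * (x * b j - y * b j))"
      by (simp add: w_def sum_distrib_left algebra_simps)
    also have "\<dots> = (\<Sum>j<n. h (vec_index v j) * (\<Sum>i<n. h (coord (x * b j) i - coord (y * b j) i) * b i))"
    proof (rule sum.cong)
      fix j assume "j \<in> {..<n}"
      then have "x * b j - y * b j =
          (\<Sum>i<n. h (coord (x * b j) i) * b i) - (\<Sum>i<n. h (coord (y * b j) i) * b i)"
        using coord Kmult x y bK by (metis lessThan_iff)
      then show "h (vec_index v j) * (x * b j - y * b j) =
          h (vec_index v j) * (\<Sum>i<n. h (coord (x * b j) i - coord (y * b j) i) * b i)"
        by (simp add: hom_distribs left_diff_distrib sum_subtractf)
    qed simp
    also have "\<dots> = (\<Sum>i<n. \<Sum>j<n. h ((coord (x * b j) i - coord (y * b j) i) * vec_index v j) * b i)"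
      by (subst sum.swap) (simp add: sum_distrib_left hom_distribs mult_ac)
    also have "\<dots> = (\<Sum>i<n. h (\<Sum>j<n. (coord (x * b j) i - coord (y * b j) i) * vec_index v j) * b i)"
      by (simp add: hom_sum sum_distrib_right)
    also have "\<dots> = 0" by (simp add: entry)
    finally show "x = y" using \<open>w \<noteq> 0\<close> by simp
  qed
  show ?thesis by (rule that[of M]) (use carr key in auto)
qed

section \<open>Independent sets of the singular difference graph\<close>

lemma det_diff_eq_0_if_row_eq:
  fixes A B :: "'a :: comm_ring_1 mat"
  assumes "A \<in> carrier_mat n n" "B \<in> carrier_mat n n" "i < n"
    and "\<And>j. j < n \<Longrightarrow> A $$ (i, j) = B $$ (i, j)"
  shows "det (A - B) = 0"
  using laplace_expansion_row[of "A - B" n i] minus_carrier_mat[OF assms(2), of A] assms by simp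

text \<open>Pigeonhole on first rows; there is a first row because \<open>n > 0\<close>.\<close>
lemma independent_set_card_le:
  fixes S :: "'a :: {field, finite} mat set"
  assumes S: "independent_set (singular_difference_graph n) S" and n: "n > 0"
  shows "card S \<le> CARD('a) ^ n"
proof -
  let ?r = "\<lambda>A :: 'a mat. map (\<lambda>j. A $$ (0, j)) [0..<n]"
  let ?L = "{xs :: 'a list. set xs \<subseteq> UNIV \<and> length xs = n}"
  have "inj_on ?r S"
  proof (rule inj_onI)
    fix A B assume AB: "A \<in> S" "B \<in> S" "?r A = ?r B"
    then have carr: "A \<in> carrier_mat n n" "B \<in> carrier_mat n n"
      using S by (auto simp: independent_set_def singular_difference_graph_def)
    then have "det (A - B) = 0"
      using AB(3) n by (intro det_diff_eq_0_if_row_eq[of _ n _ 0]) auto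
    with AB carr S show "A = B"
      by (auto simp: independent_set_def singular_difference_graph_def)
  qed
  moreover have "?r ` S \<subseteq> ?L" by auto
  moreover have "finite ?L" by (rule finite_lists_length_eq) simp
  ultimately have "card S \<le> card ?L" by (rule card_inj_on_le)
  also have "card ?L = CARD('a) ^ n" by (rule card_lists_length_eq) simp
  finally show ?thesis .
qed

text \<open>The matrices of multiplication by the elements of the field with \<open>q ^ n\<close> elements.\<close>
lemma exists_independent_set:
  assumes q: "primepow CARD('a :: {field, finite})" and n: "n > 0"
  obtains S :: "'a :: {field, finite} mat set"
  where "independent_set (singular_difference_graph n) S" "card S = CARD('a) ^ n"
proof -
  obtain k where k: "Factorial_Ring.prime CHAR('a)" "k > 0" "CARD('a) = CHAR('a) ^ k"
    using card_eq_CHAR_power[OF q] .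
  define Q where "Q = CARD('a) ^ n"
  define K where "K = {x :: 'a alg_closure. x ^ Q = x}"
  have hom: "field_hom (to_ac :: 'a \<Rightarrow> _)"
    by unfold_locales auto
  have QC: "Q = CHAR('a alg_closure) ^ (k * n)"
    by (simp add: Q_def k(3) power_mult)
  have Q1: "Q > 1"
    unfolding QC using k n prime_gt_1_nat[OF k(1)] one_less_power[of "CHAR('a)" "k * n"] by simp
  have Q0: "of_nat Q = (0 :: 'a alg_closure)"
    unfolding QC using k n by (simp add: of_nat_eq_0_iff_char_dvd dvd_power)
  have cardK: "card K = CARD('a) ^ n"
    using card_fixed_points_power[OF Q1 Q0] by (simp only: K_def Q_def)
  have "a ^ Q = a" for a :: 'a
    unfolding Q_def by (induction n) (simp_all add: power_mult power_card_eq_self)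
  then have scale: "to_ac a * x \<in> K" if "x \<in> K" for a x
    using that by (simp add: K_def power_mult_distrib flip: to_ac_power)
  have add: "x + y \<in> K" if "x \<in> K" "y \<in> K" for x y
    using that freshmans_dream'[OF _ QC, of x y] k(1) by (simp add: K_def)
  have mult: "x * y \<in> K" if "x \<in> K" "y \<in> K" for x y
    using that by (simp add: K_def power_mult_distrib)
  have zero: "0 \<in> K" using Q1 by (simp add: K_def)
  obtain b where b: "\<forall>i<n. b i \<in> K"
    "\<forall>c :: nat \<Rightarrow> 'a. (\<Sum>i<n. to_ac (c i) * b i) = 0 \<longrightarrow> (\<forall>i<n. c i = 0)"
    "\<forall>x\<in>K. \<exists>c :: nat \<Rightarrow> 'a. x = (\<Sum>i<n. to_ac (c i) * b i)"
    by (rule subspace_basis_of_card[OF hom zero add scale cardK])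
  obtain M :: "'a alg_closure \<Rightarrow> 'a mat" where M: "range M \<subseteq> carrier_mat n n"
    "\<forall>x\<in>K. \<forall>y\<in>K. det (M x - M y) = 0 \<longrightarrow> x = y"
    by (rule multiplication_matrices[OF hom mult b])
  \<comment> \<open>Injectivity of \<open>M\<close> follows because a zero matrix of positive size is singular.\<close>
  have "det (M x - M x) = 0" for x
    using M(1) n by (intro det_diff_eq_0_if_row_eq[of _ n _ 0]) auto
  with M(2) have "inj_on M K"
    unfolding inj_on_def by metis
  then have "card (M ` K) = CARD('a) ^ n"
    by (simp add: card_image cardK)
  moreover have "independent_set (singular_difference_graph n) (M ` K)"
    using M by (auto simp: independent_set_def singular_difference_graph_def)
  ultimately show ?thesis using that by blast
qed

theorem theorem4p9:
  fixes n q :: nat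
  assumes "primepow q"
    and "CARD('a :: {field, finite}) = q"
    and "n \<ge> 2"
  shows "independence_number
           (singular_difference_graph n :: 'a mat pair_pre_digraph) = q ^ n"
proof -
  let ?G = "singular_difference_graph n :: 'a mat pair_pre_digraph"
  have n: "n > 0" using assms(3) by simp
  obtain S where "independent_set ?G S" "card S = q ^ n"
    using exists_independent_set[where ?'a = 'a, of n] assms n by metis
  moreover have "card T \<le> q ^ n" if "independent_set ?G T" for T
    using independent_set_card_le[OF that n] assms(2) by simp
  moreover have "finite {card S | S. independent_set ?G S}"
    by (rule finite_independent_sets) (simp add: singular_difference_graph_def finite_carrier_mat)
  ultimately show ?thesis
    unfolding independence_number_def by (intro Max_eqI) (auto, metis)
qed

end
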